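(* Let $A$ be a function algebra over $\mathbb{R}$ (the real line of times $t$) with values in an operator algebra, and let $R$ denote the indefinite Riemann integral operator on $A$, $R(f)(t)=\int_0^t f(s)\,ds$. Then, for $a\in A$, Magnus' expansion $\Omega[a]=\sum_{n>0}\Omega_n[a]$ is given by the formula $$ \Omega[a](t)=R\bigl(\chi^0(a)\bigr)(t), $$ where $\chi^0$ is the weight-zero CBHD recursion associated with $R$.
   Context: Here $A$ is an associative unital algebra, under pointwise multiplication, of continuous functions of $t\in\mathbb{R}$ with values in an associative unital operator algebra (for instance, $n\times n$ matrices), closed under the indefinite Riemann integral $R$. $\operatorname{ad}u\,(v)=uv-vu$. The $B_n$ are the Bernoulli numbers, $\frac{z}{e^z-1}=\sum_{n\ge0}\frac{B_n}{n!}z^n$ (so $B_1=-\tfrac12$). Identities are understood as identities of formal series graded by the number of occurrences of $a$: one replaces $a$ by $\lambda a$, with $\lambda$ a formal parameter commuting with everything, and works in $A[[\lambda]]$ with its $\lambda$-adic filtration, $R$ acting coefficientwise; the degree-$n$ component is the coefficient of $\lambda^n$. Magnus' expansion: for the initial value problem $\frac{d}{dt}F(t)=a(t)F(t)$, $F(0)=1$, one writes $F(t)=\exp(\Omega[a](t))$ with $\Omega[a](0)=0$. Magnus' expansion is the series $\Omega[a](t)=\sum_{n>0}\Omega_n[a](t)$, $\Omega_n[a]$ being homogeneous of degree $n$ in $a$; its terms are found recursively from the differential equation $$\frac{d}{dt}\Omega[a](t)=\frac{\operatorname{ad}\Omega[a]}{e^{\operatorname{ad}\Omega[a]}-1}(a)(t)=\sum_{n\ge0}\frac{B_n}{n!}(\operatorname{ad}\Omega[a])^n(a)(t),\qquad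 \Omega[a](0)=0.$$ The weight-zero CBHD (Campbell--Baker--Hausdorff--Dynkin) recursion $\chi^0$ associated with $R$ is the nonlinear map inductively defined by $$\chi^0(a)=\frac{\operatorname{ad}R(\chi^0(a))}{e^{\operatorname{ad}R(\chi^0(a))}-1}(a)=a+\sum_{n>0}\frac{B_n}{n!}\bigl[\operatorname{ad}R(\chi^0(a))\bigr]^n(a).$$ *)

theory Defs
  imports
    "HOL-Analysis.Analysis"
    "HOL-Computational_Algebra.Formal_Power_Series"
    "HOL-Library.Function_Algebras"
begin

text \<open>
  Functions of time carry the pointwise ring structure of \<open>Function_Algebras\<close>.  A formal series
  in the central parameter \<open>\<lambda>\<close> is an \<open>fps\<close> whose coefficients are such functions, and infinite
  sums of series (\<open>sums\<close>) are taken in the metric of the type \<open>fps\<close>, whose topology is the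
  \<open>\<lambda>\<close>-adic one.
\<close>

text \<open>The oriented integral from \<open>0\<close> to \<open>t\<close>, for either sign of \<open>t\<close>.\<close>

definition riemann_int :: "(real \<Rightarrow> 'b::banach) \<Rightarrow> real \<Rightarrow> 'b" where
  "riemann_int f t = (if 0 \<le> t then integral {0..t} f else - integral {t..0} f)"

locale function_algebra =
  fixes A :: "(real \<Rightarrow> 'b::{real_normed_algebra, real_algebra_1, banach}) set"
  assumes continuous: "f \<in> A \<Longrightarrow> continuous_on UNIV f"
    and one_closed: "1 \<in> A"
    and add_closed: "f \<in> A \<Longrightarrow> g \<in> A \<Longrightarrow> f + g \<in> A"
    and scale_closed: "f \<in> A \<Longrightarrow> (\<lambda>t. c *\<^sub>R f t) \<in> A"
    and mult_closed: "f \<in> A \<Longrightarrow> g \<in> A \<Longrightarrow> f * g \<in> A"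
    and int_closed: "f \<in> A \<Longrightarrow> riemann_int f \<in> A"

definition series_over :: "'c set \<Rightarrow> 'c fps set" where
  "series_over A = {X. \<forall>n. fps_nth X n \<in> A}"

definition coeffwise :: "('c \<Rightarrow> 'c) \<Rightarrow> 'c fps \<Rightarrow> 'c fps" where
  "coeffwise T X = Abs_fps (\<lambda>n. T (fps_nth X n))"

definition scale_series ::
    "real \<Rightarrow> (real \<Rightarrow> 'b::real_vector) fps \<Rightarrow> (real \<Rightarrow> 'b) fps" where
  "scale_series c = coeffwise (\<lambda>f t. c *\<^sub>R f t)"

definition bernoulli_number :: "nat \<Rightarrow> real" where
  "bernoulli_number n = fact n * fps_nth (fps_X / (fps_exp 1 - 1)) n"

definition ad :: "'r::ring \<Rightarrow> 'r \<Rightarrow> 'r" where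
  "ad u v = u * v - v * u"

text \<open>The series \<open>\<lambda>a\<close>, which replaces \<open>a\<close> in all identities below; the coefficient of \<open>\<lambda>\<^sup>n\<close>
  is then the component of degree \<open>n\<close> in \<open>a\<close>.\<close>

definition marked :: "'r::ring_1 \<Rightarrow> 'r fps" where
  "marked a = fps_const a * fps_X"

text \<open>\<open>U\<close> is the value of \<open>ad Z / (exp (ad Z) - 1)\<close> at \<open>V\<close>.\<close>

definition is_bernoulli_ad :: "(real \<Rightarrow> 'b::real_algebra_1) fps \<Rightarrow> (real \<Rightarrow> 'b) fps \<Rightarrow>
    (real \<Rightarrow> 'b) fps \<Rightarrow> bool" where
  "is_bernoulli_ad Z V U \<longleftrightarrow>
     (\<lambda>n. scale_series (bernoulli_number n / fact n) ((ad Z ^^ n) V)) sums U"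

definition is_exp_series :: "(real \<Rightarrow> 'b::real_algebra_1) fps \<Rightarrow> (real \<Rightarrow> 'b) fps \<Rightarrow> bool" where
  "is_exp_series Z F \<longleftrightarrow> (\<lambda>n. scale_series (1 / fact n) (Z ^ n)) sums F"

definition has_time_derivative ::
    "(real \<Rightarrow> 'b::real_normed_vector) fps \<Rightarrow> (real \<Rightarrow> 'b) fps \<Rightarrow> bool" where
  "has_time_derivative X Y \<longleftrightarrow>
     (\<forall>n t. (fps_nth X n has_vector_derivative fps_nth Y n t) (at t))"

text \<open>
  The weight-zero CBHD recursion associated with an operator \<open>R\<close>.  The coefficient of \<open>\<lambda>\<^sup>n\<close> on the
  right-hand side of the defining equation involves only coefficients of \<open>X\<close> below \<open>n\<close>, so the
  equation determines \<open>X\<close> inductively.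
\<close>

definition cbhd0 :: "(real \<Rightarrow> 'b::real_algebra_1) set \<Rightarrow>
    ((real \<Rightarrow> 'b) \<Rightarrow> (real \<Rightarrow> 'b)) \<Rightarrow> (real \<Rightarrow> 'b) \<Rightarrow> (real \<Rightarrow> 'b) fps" where
  "cbhd0 A R a =
     (THE X. X \<in> series_over A \<and> is_bernoulli_ad (coeffwise R X) (marked a) X)"

text \<open>
  \<open>\<Omega>\<close> is Magnus' expansion of \<open>a\<close>: it has no term of degree \<open>0\<close> in \<open>a\<close>, vanishes at time \<open>0\<close>, its
  exponential solves the initial value problem \<open>F' = aF\<close>, \<open>F(0) = 1\<close>, and its terms obey
  Magnus' differential equation.
\<close>

definition is_magnus_expansion ::
    "(real \<Rightarrow> 'b::{real_normed_algebra, real_algebra_1}) set \<Rightarrow> (real \<Rightarrow> 'b) \<Rightarrow>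
     (real \<Rightarrow> 'b) fps \<Rightarrow> bool" where
  "is_magnus_expansion A a \<Omega> \<longleftrightarrow>
     \<Omega> \<in> series_over A \<and> fps_nth \<Omega> 0 = 0 \<and> (\<forall>n. fps_nth \<Omega> n 0 = 0) \<and>
     (\<exists>F. is_exp_series \<Omega> F \<and> has_time_derivative F (marked a * F) \<and>
          (\<forall>n. fps_nth F n 0 = (if n = 0 then 1 else 0))) \<and>
     (\<exists>W. is_bernoulli_ad \<Omega> (marked a) W \<and> has_time_derivative \<Omega> W)"

end

theory Submission
  imports Defs
begin

text \<open>
  Both sides of the equivalence describe one differential equation.  Integrating Magnus' equation
  \<open>\<Omega>' = ad \<Omega> / (exp (ad \<Omega>) - 1) (\<lambda>a)\<close>, \<open>\<Omega>(0) = 0\<close>, shows that its right-hand side \<open>X\<close> has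
  \<open>\<Omega> = R X\<close>, so that \<open>X\<close> solves the CBHD recursion; conversely, if \<open>X\<close> solves the recursion, then
  \<open>R X\<close> has derivative \<open>X\<close> and solves Magnus' equation.  The fundamental theorem of calculus gives
  both directions (\<open>riemann_int_has_derivative\<close>, \<open>riemann_int_unique\<close>), provided that the recursion has
  exactly one solution.  It does, because its right-hand side is a contraction for the \<open>\<lambda>\<close>-adic
  metric: the factor \<open>\<lambda>\<close> in \<open>\<lambda>a\<close> raises by one the degree up to which two series agree
  (\<open>fps_contraction_fixpoint\<close>, \<open>cbhd_recursion_ex1\<close>).

  It remains to see that a solution \<open>\<Omega>\<close> really is the logarithm of the solution of \<open>F' = \<lambda>a F\<close>.
  Left multiplication by \<open>\<Omega>\<close> is the sum of \<open>ad \<Omega>\<close> and right multiplication by \<open>\<Omega>\<close>, and these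
  commute; a binomial expansion therefore writes the derivative of \<open>\<Omega>\<^sup>n\<close> with all powers of \<open>\<Omega>\<close> on
  the right (\<open>binomial_ad_step\<close>, \<open>has_time_derivative_power\<close>).  Dividing by \<open>n!\<close> and summing, one
  obtains \<open>(exp \<Omega>)' = ((exp (ad \<Omega>) - 1) / ad \<Omega>) (\<Omega>') exp \<Omega>\<close> (\<open>has_time_derivative_exp_series\<close>), and
  the first factor is \<open>\<lambda>a\<close> because the two functions of \<open>ad \<Omega>\<close> are inverse to each other
  (\<open>bernoulli_ad_inverse\<close>).

  Every infinite sum involved has a \<open>k\<close>-th term that starts in degree at least \<open>k\<close>, so each identity
  can be checked in one degree at a time on finite sums (\<open>graded_sums_iff\<close>).
\<close>

section \<open>Locally finite sums of formal series\<close>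

definition vanishes_below :: "nat \<Rightarrow> 'r::zero fps \<Rightarrow> bool" where
  "vanishes_below n X \<longleftrightarrow> (\<forall>i<n. fps_nth X i = 0)"

lemma vanishes_below_nth: "vanishes_below n X \<Longrightarrow> i < n \<Longrightarrow> fps_nth X i = 0"
  by (simp add: vanishes_below_def)

lemma vanishes_below_mono: "vanishes_below n X \<Longrightarrow> m \<le> n \<Longrightarrow> vanishes_below m X"
  by (simp add: vanishes_below_def)

lemma vanishes_below_0 [simp]: "vanishes_below 0 X"
  by (simp add: vanishes_below_def)

lemma vanishes_below_zero [simp]: "vanishes_below n 0"
  by (simp add: vanishes_below_def)

lemma vanishes_below_add:
  fixes X Y :: "'r::monoid_add fps"
  shows "vanishes_below n X \<Longrightarrow> vanishes_below n Y \<Longrightarrow> vanishes_below n (X + Y)"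
  by (simp add: vanishes_below_def)

lemma vanishes_below_diff:
  fixes X Y :: "'r::group_add fps"
  shows "vanishes_below n X \<Longrightarrow> vanishes_below n Y \<Longrightarrow> vanishes_below n (X - Y)"
  by (simp add: vanishes_below_def)

lemma vanishes_below_sum:
  fixes f :: "'i \<Rightarrow> 'r::comm_monoid_add fps"
  shows "(\<And>k. k \<in> S \<Longrightarrow> vanishes_below n (f k)) \<Longrightarrow> vanishes_below n (sum f S)"
  by (simp add: vanishes_below_def fps_sum_nth)

lemma vanishes_below_mult:
  fixes X Y :: "'r::ring fps"
  assumes "vanishes_below m X" and "vanishes_below n Y"
  shows "vanishes_below (m + n) (X * Y)"
  unfolding vanishes_below_def
proof (intro allI impI)
  fix i assume i: "i < m + n"
  have "fps_nth X j * fps_nth Y (i - j) = 0" if "j \<le> i" for j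
  proof (cases "j < m")
    case True
    then show ?thesis using assms(1) by (simp add: vanishes_below_nth)
  next
    case False
    then have "i - j < n" using i that by simp
    then show ?thesis using assms(2) by (simp add: vanishes_below_nth)
  qed
  then show "fps_nth (X * Y) i = 0" by (simp add: fps_mult_nth)
qed

lemma vanishes_below_power:
  fixes X :: "'r::ring_1 fps"
  assumes "vanishes_below 1 X"
  shows "vanishes_below k (X ^ k)"
proof (induction k)
  case (Suc k)
  show ?case using vanishes_below_mult[OF assms Suc] by simp
qed simp

lemma sums_vanishes_below:
  fixes f :: "nat \<Rightarrow> 'r::ab_group_add fps"
  assumes "f sums U" and "\<And>k. vanishes_below j (f k)"
  shows "vanishes_below j U"
  unfolding vanishes_below_def
proof (intro allI impI)
  fix i assume "i < j"
  have "eventually (\<lambda>N. fps_nth (\<Sum>k<N. f k) i = fps_nth U i) sequentially"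
    using assms(1) unfolding sums_def tendsto_fps_iff by blast
  then obtain N where "fps_nth (\<Sum>k<N. f k) i = fps_nth U i"
    unfolding eventually_sequentially by blast
  moreover have "fps_nth (\<Sum>k<N. f k) i = 0"
    by (simp add: fps_sum_nth vanishes_below_nth[OF assms(2) \<open>i < j\<close>])
  ultimately show "fps_nth U i = 0" by simp
qed

text \<open>When the \<open>k\<close>-th term starts in degree \<open>k\<close>, only finitely many terms reach a given degree;
  convergence is then automatic and every question about the sum becomes one about finite sums.\<close>

lemma graded_sums_iff:
  fixes f :: "nat \<Rightarrow> 'r::ab_group_add fps"
  assumes f: "\<And>k. vanishes_below k (f k)"
  shows "f sums U \<longleftrightarrow> (\<forall>n. fps_nth U n = (\<Sum>k\<le>n. fps_nth (f k) n))"
proof -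
  have partial: "fps_nth (\<Sum>k<N. f k) n = (\<Sum>k\<le>n. fps_nth (f k) n)" if "N \<ge> Suc n" for N n
  proof -
    have "(\<Sum>k<N. fps_nth (f k) n) = (\<Sum>k\<le>n. fps_nth (f k) n)"
    proof (rule sum.mono_neutral_right)
      show "\<forall>k\<in>{..<N} - {..n}. fps_nth (f k) n = 0"
        using vanishes_below_nth[OF f] by auto
    qed (use that in auto)
    then show ?thesis by (simp add: fps_sum_nth)
  qed
  have "eventually (\<lambda>N. fps_nth (\<Sum>k<N. f k) n = fps_nth U n) sequentially
      \<longleftrightarrow> fps_nth U n = (\<Sum>k\<le>n. fps_nth (f k) n)" for n
  proof
    assume "eventually (\<lambda>N. fps_nth (\<Sum>k<N. f k) n = fps_nth U n) sequentially"
    then obtain N0 where "\<And>N. N \<ge> N0 \<Longrightarrow> fps_nth (\<Sum>k<N. f k) n = fps_nth U n"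
      unfolding eventually_sequentially by blast
    from this[of "max N0 (Suc n)"] partial[of n "max N0 (Suc n)"]
    show "fps_nth U n = (\<Sum>k\<le>n. fps_nth (f k) n)" by simp
  next
    assume "fps_nth U n = (\<Sum>k\<le>n. fps_nth (f k) n)"
    then show "eventually (\<lambda>N. fps_nth (\<Sum>k<N. f k) n = fps_nth U n) sequentially"
      unfolding eventually_sequentially using partial by metis
  qed
  then show ?thesis unfolding sums_def tendsto_fps_iff by blast
qed

lemma graded_summable:
  fixes f :: "nat \<Rightarrow> 'r::ab_group_add fps"
  assumes "\<And>k. vanishes_below k (f k)"
  shows "summable f"
proof -
  have "f sums Abs_fps (\<lambda>n. \<Sum>k\<le>n. fps_nth (f k) n)"
    using graded_sums_iff[OF assms] by simp
  then show ?thesis by (rule sums_summable)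
qed

lemma graded_sums_remainder:
  fixes f :: "nat \<Rightarrow> 'r::ab_group_add fps"
  assumes f: "\<And>k. vanishes_below k (f k)" and "f sums U"
  shows "vanishes_below (Suc n) (U - (\<Sum>k\<le>n. f k))"
  unfolding vanishes_below_def
proof (intro allI impI)
  fix i assume "i < Suc n"
  have "(\<Sum>k\<le>n. fps_nth (f k) i) = (\<Sum>k\<le>i. fps_nth (f k) i)"
  proof (rule sum.mono_neutral_right)
    show "\<forall>k\<in>{..n} - {..i}. fps_nth (f k) i = 0"
      using vanishes_below_nth[OF f] by auto
  qed (use \<open>i < Suc n\<close> in auto)
  then show "fps_nth (U - (\<Sum>k\<le>n. f k)) i = 0"
    using assms(2) by (simp add: graded_sums_iff[OF f] fps_sum_nth)
qed

text \<open>Products of graded sums arise as sums over a square; they are collected by total degree.\<close>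

lemma sum_square_eq_triangle:
  fixes h :: "nat \<Rightarrow> nat \<Rightarrow> 'c::comm_monoid_add"
  assumes "\<And>i j. n < i + j \<Longrightarrow> h i j = 0"
  shows "(\<Sum>i\<le>n. \<Sum>j\<le>n. h i j) = (\<Sum>k\<le>n. \<Sum>i\<le>k. h i (k - i))"
proof -
  have "(\<Sum>i\<le>n. \<Sum>j\<le>n. h i j) = (\<Sum>(i, j)\<in>{..n} \<times> {..n}. h i j)"
    by (simp add: sum.cartesian_product)
  also have "\<dots> = (\<Sum>(i, j)\<in>{(i, j). i + j \<le> n}. h i j)"
  proof (rule sum.mono_neutral_right)
    show "\<forall>p\<in>{..n} \<times> {..n} - {(i, j). i + j \<le> n}. (case p of (i, j) \<Rightarrow> h i j) = 0"
      by (auto intro!: assms)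
  qed auto
  also have "\<dots> = (\<Sum>k\<le>n. \<Sum>i\<le>k. h i (k - i))"
    by (rule sum.triangle_reindex_eq)
  finally show ?thesis .
qed

lemma graded_sums_Cauchy_product:
  fixes p q :: "nat \<Rightarrow> 'r::ring fps"
  assumes p: "\<And>k. vanishes_below k (p k)" "p sums P"
    and q: "\<And>k. vanishes_below k (q k)" "q sums Q"
  shows "(\<lambda>k. \<Sum>i\<le>k. p i * q (k - i)) sums (P * Q)"
proof -
  have pq: "vanishes_below (i + j) (p i * q j)" for i j
    by (intro vanishes_below_mult p q)
  have graded: "vanishes_below k (\<Sum>i\<le>k. p i * q (k - i))" for k
    by (rule vanishes_below_sum) (use pq in \<open>metis le_add_diff_inverse atMost_iff\<close>)
  have "fps_nth (P * Q) n = (\<Sum>k\<le>n. fps_nth (\<Sum>i\<le>k. p i * q (k - i)) n)" for n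
  proof -
    let ?P = "\<Sum>i\<le>n. p i" and ?Q = "\<Sum>j\<le>n. q j"
    have "vanishes_below (Suc n) ((P - ?P) * Q)" "vanishes_below (Suc n) (?P * (Q - ?Q))"
      using vanishes_below_mult[OF graded_sums_remainder[OF p, of n] vanishes_below_0[of Q]]
        vanishes_below_mult[OF vanishes_below_0[of ?P] graded_sums_remainder[OF q, of n]]
      by simp_all
    then have "fps_nth (((P - ?P) * Q) + (?P * (Q - ?Q))) n = 0"
      by (simp add: vanishes_below_nth)
    then have "fps_nth (P * Q) n = fps_nth (?P * ?Q) n"
      by (simp add: algebra_simps)
    also have "\<dots> = (\<Sum>i\<le>n. \<Sum>j\<le>n. fps_nth (p i * q j) n)"
      by (simp add: sum_product fps_sum_nth)
    also have "\<dots> = (\<Sum>k\<le>n. \<Sum>i\<le>k. fps_nth (p i * q (k - i)) n)"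
      by (rule sum_square_eq_triangle) (rule vanishes_below_nth[OF pq])
    finally show ?thesis by (simp add: fps_sum_nth)
  qed
  then show ?thesis using graded_sums_iff[OF graded] by blast
qed

section \<open>Scalars and the adjoint action\<close>

lemma scale_series_nth [simp]: "fps_nth (scale_series c X) n = (\<lambda>t. c *\<^sub>R fps_nth X n t)"
  by (simp add: scale_series_def coeffwise_def)

lemma vanishes_below_scale:
  fixes X :: "(real \<Rightarrow> 'b::real_vector) fps"
  shows "vanishes_below n X \<Longrightarrow> vanishes_below n (scale_series c X)"
  by (simp add: vanishes_below_def zero_fun_def)

lemma sum_fun_apply: "(\<Sum>i\<in>S. f i) t = (\<Sum>i\<in>S. f i t)"
  for f :: "'i \<Rightarrow> 'x \<Rightarrow> 'c::comm_monoid_add"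
  by (induction S rule: infinite_finite_induct) auto

lemma scale_series_add: "scale_series c (X + Y) = scale_series c X + scale_series c Y"
  by (rule fps_ext) (simp add: fun_eq_iff scaleR_add_right)

lemma scale_series_diff: "scale_series c (X - Y) = scale_series c X - scale_series c Y"
  by (rule fps_ext) (simp add: fun_eq_iff scaleR_diff_right)

lemma scale_series_zero: "scale_series c 0 = 0"
  by (rule fps_ext) (simp add: fun_eq_iff)

lemma scale_series_sum: "scale_series c (\<Sum>i\<in>S. f i) = (\<Sum>i\<in>S. scale_series c (f i))"
  by (induction S rule: infinite_finite_induct) (simp_all add: scale_series_zero scale_series_add)

lemma scale_series_scale: "scale_series c (scale_series d X) = scale_series (c * d) X"
  by (rule fps_ext) simp

lemma scale_series_sum_left: "scale_series (\<Sum>i\<in>S. f i) X = (\<Sum>i\<in>S. scale_series (f i) X)"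
  by (rule fps_ext) (simp add: fun_eq_iff fps_sum_nth sum_fun_apply scaleR_sum_left)

lemma scale_series_one: "scale_series 1 X = X"
  by (rule fps_ext) simp

lemma scale_series_zero_left: "scale_series 0 X = 0"
  by (rule fps_ext) (simp add: fun_eq_iff)

lemma scale_series_mult_left:
  fixes X Y :: "(real \<Rightarrow> 'b::real_algebra_1) fps"
  shows "scale_series c X * Y = scale_series c (X * Y)"
  by (rule fps_ext) (simp add: fun_eq_iff fps_mult_nth sum_fun_apply scaleR_sum_right)

lemma scale_series_mult_right:
  fixes X Y :: "(real \<Rightarrow> 'b::real_algebra_1) fps"
  shows "X * scale_series c Y = scale_series c (X * Y)"
  by (rule fps_ext) (simp add: fun_eq_iff fps_mult_nth sum_fun_apply scaleR_sum_right)

lemma scale_series_of_nat: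
  fixes X :: "(real \<Rightarrow> 'b::real_algebra_1) fps"
  shows "of_nat n * X = scale_series (of_nat n) X"
proof (induction n)
  case 0
  show ?case by (simp add: scale_series_zero_left)
next
  case (Suc n)
  have "scale_series (of_nat (Suc n)) X = X + scale_series (of_nat n) X"
    by (rule fps_ext) (simp add: fun_eq_iff scaleR_add_left)
  then show ?case using Suc by (simp add: distrib_right)
qed

lemma ad_add: "ad Z (X + Y) = ad Z X + ad Z Y"
  by (simp add: ad_def algebra_simps)

lemma ad_pow_add: "(ad Z ^^ m) (X + Y) = (ad Z ^^ m) X + (ad Z ^^ m) Y"
  by (induction m) (simp_all add: ad_add)

lemma ad_pow_zero: "(ad Z ^^ m) 0 = 0"
  by (induction m) (simp_all add: ad_def)

lemma ad_pow_sum: "(ad Z ^^ m) (\<Sum>i\<in>S. f i) = (\<Sum>i\<in>S. (ad Z ^^ m) (f i))"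
  by (induction S rule: infinite_finite_induct) (simp_all add: ad_pow_zero ad_pow_add)

lemma ad_scale:
  fixes X Z :: "(real \<Rightarrow> 'b::real_algebra_1) fps"
  shows "ad Z (scale_series c X) = scale_series c (ad Z X)"
  by (simp add: ad_def scale_series_mult_left scale_series_mult_right scale_series_diff)

lemma ad_pow_scale:
  fixes X Z :: "(real \<Rightarrow> 'b::real_algebra_1) fps"
  shows "(ad Z ^^ m) (scale_series c X) = scale_series c ((ad Z ^^ m) X)"
  by (induction m) (simp_all add: ad_scale)

lemma vanishes_below_ad:
  fixes X Z :: "'r::ring fps"
  assumes "vanishes_below m Z" and "vanishes_below n X"
  shows "vanishes_below (m + n) (ad Z X)"
  using vanishes_below_mult[OF assms] vanishes_below_mult[OF assms(2,1)]
  by (simp add: ad_def vanishes_below_diff add.commute)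

lemma vanishes_below_ad_pow:
  fixes X Z :: "'r::ring fps"
  assumes Z: "vanishes_below 1 Z" and X: "vanishes_below j X"
  shows "vanishes_below (j + k) ((ad Z ^^ k) X)"
proof (induction k)
  case (Suc k)
  show ?case using vanishes_below_ad[OF Z Suc] by simp
qed (simp add: X)

lemma vanishes_below_ad_pow_same:
  fixes X Z :: "'r::ring fps"
  assumes "vanishes_below j X"
  shows "vanishes_below j ((ad Z ^^ k) X)"
proof (induction k)
  case (Suc k)
  show ?case using vanishes_below_ad[OF vanishes_below_0 Suc] by simp
qed (simp add: assms)

text \<open>One degree of agreement is gained, because the difference \<open>Z - Z'\<close>, of order \<open>n\<close>, only enters
  multiplied by iterated commutators with \<open>V\<close>, of order at least one.  This gain is what makes
  the CBHD recursion determine its solution.\<close>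

lemma ad_pow_perturbation:
  fixes V Z Z' :: "'r::ring fps"
  assumes Z: "vanishes_below n (Z - Z')" and V: "vanishes_below 1 V"
  shows "vanishes_below (Suc n) ((ad Z ^^ k) V - (ad Z' ^^ k) V)"
proof (induction k)
  case (Suc k)
  let ?W = "(ad Z ^^ k) V" and ?W' = "(ad Z' ^^ k) V"
  have "ad Z ?W - ad Z' ?W' = ad (Z - Z') ?W + ad Z' (?W - ?W')"
    by (simp add: ad_def algebra_simps)
  moreover have "vanishes_below (Suc n) (ad (Z - Z') ?W)"
    using vanishes_below_ad[OF Z vanishes_below_ad_pow_same[OF V]] by simp
  moreover have "vanishes_below (Suc n) (ad Z' (?W - ?W'))"
    using vanishes_below_ad[OF vanishes_below_0 Suc] by simp
  ultimately show ?case by (simp add: vanishes_below_add)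
qed simp

section \<open>Power series in the adjoint action\<close>

lemma graded_ad_series:
  fixes V Z :: "(real \<Rightarrow> 'b::real_algebra_1) fps"
  assumes "vanishes_below 1 Z"
  shows "vanishes_below k (scale_series c ((ad Z ^^ k) V))"
  using vanishes_below_ad_pow[OF assms vanishes_below_0] by (simp add: vanishes_below_scale)

lemma ad_series_sums_iff:
  fixes V Z :: "(real \<Rightarrow> 'b::real_algebra_1) fps"
  assumes "vanishes_below 1 Z"
  shows "(\<lambda>k. scale_series (c k) ((ad Z ^^ k) V)) sums U
    \<longleftrightarrow> (\<forall>n. fps_nth U n = (\<Sum>k\<le>n. fps_nth (scale_series (c k) ((ad Z ^^ k) V)) n))"
  by (rule graded_sums_iff) (rule graded_ad_series[OF assms])

text \<open>Functional calculus: power series in \<open>ad Z\<close> compose like the formal power series themselves.  In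
  degree \<open>n\<close> the inner series may be cut off after \<open>n\<close> terms, and the remaining finite double sum
  is regrouped by the total power of \<open>ad Z\<close>.\<close>

lemma ad_series_compose:
  fixes V Z U W :: "(real \<Rightarrow> 'b::real_algebra_1) fps" and f g :: "real fps"
  assumes Z: "vanishes_below 1 Z"
    and U: "(\<lambda>k. scale_series (fps_nth f k) ((ad Z ^^ k) V)) sums U"
    and W: "(\<lambda>m. scale_series (fps_nth g m) ((ad Z ^^ m) U)) sums W"
  shows "(\<lambda>k. scale_series (fps_nth (g * f) k) ((ad Z ^^ k) V)) sums W"
proof -
  note graded = graded_ad_series[OF Z]
  have "fps_nth W n = (\<Sum>k\<le>n. fps_nth (scale_series (fps_nth (g * f) k) ((ad Z ^^ k) V)) n)" for n
  proof -
    let ?U = "\<Sum>k\<le>n. scale_series (fps_nth f k) ((ad Z ^^ k) V)"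
    let ?h = "\<lambda>m k. fps_nth (scale_series (fps_nth g m * fps_nth f k) ((ad Z ^^ (m + k)) V)) n"
    have trunc: "fps_nth ((ad Z ^^ m) U) n = fps_nth ((ad Z ^^ m) ?U) n" for m
    proof -
      have "vanishes_below (Suc n) ((ad Z ^^ m) (U - ?U))"
        by (intro vanishes_below_ad_pow_same graded_sums_remainder[OF graded U])
      then have "fps_nth ((ad Z ^^ m) (U - ?U)) n = 0"
        by (simp add: vanishes_below_nth)
      then show ?thesis
        using ad_pow_add[where Z=Z and m=m and X="U - ?U" and Y="?U"] by simp
    qed
    have "fps_nth W n = (\<Sum>m\<le>n. fps_nth (scale_series (fps_nth g m) ((ad Z ^^ m) U)) n)"
      using W unfolding ad_series_sums_iff[OF Z] by blast
    also have "\<dots> = (\<Sum>m\<le>n. fps_nth (scale_series (fps_nth g m) ((ad Z ^^ m) ?U)) n)"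
      by (simp add: trunc)
    also have "\<dots> = (\<Sum>m\<le>n. \<Sum>k\<le>n. ?h m k)"
      by (simp only: ad_pow_sum ad_pow_scale scale_series_sum scale_series_scale fps_sum_nth
          funpow_add o_apply)
    also have "\<dots> = (\<Sum>k\<le>n. \<Sum>m\<le>k. ?h m (k - m))"
      by (rule sum_square_eq_triangle) (rule vanishes_below_nth[OF graded])
    also have "\<dots> = (\<Sum>k\<le>n. fps_nth (scale_series (fps_nth (g * f) k) ((ad Z ^^ k) V)) n)"
      by (rule sum.cong[OF refl])
        (simp only: fps_mult_nth scale_series_sum_left fps_sum_nth atLeast0AtMost,
          rule sum.cong[OF refl], simp)
    finally show ?thesis .
  qed
  then show ?thesis unfolding ad_series_sums_iff[OF Z] by blast
qed

text \<open>This is \<open>((e\<^sup>z - 1) / z) (z / (e\<^sup>z - 1)) = 1\<close>, obtained by cancelling \<open>z\<close> from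
  \<open>e\<^sup>z - 1 = z E(z)\<close>, where \<open>E(0) = 1\<close>.\<close>

lemma bernoulli_fps_mult:
  "Abs_fps (\<lambda>n. 1 / fact (Suc n)) * Abs_fps (\<lambda>n. bernoulli_number n / fact n) = (1 :: real fps)"
proof -
  let ?E = "Abs_fps (\<lambda>n. 1 / fact (Suc n)) :: real fps"
  let ?D = "fps_exp 1 - 1 :: real fps"
  have D: "?D = fps_X * ?E"
  proof (rule fps_ext)
    fix n show "fps_nth ?D n = fps_nth (fps_X * ?E) n" by (cases n) (simp_all add: algebra_simps)
  qed
  have E: "fps_nth ?E 0 = 1" by simp
  then have "?E \<noteq> 0" by (metis fps_zero_nth zero_neq_one)
  have b: "Abs_fps (\<lambda>n. bernoulli_number n / fact n) = fps_X / ?D"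
    by (rule fps_ext) (simp add: bernoulli_number_def)
  have "?E dvd 1"
    by (metis E fps_is_unit_iff zero_neq_one)
  then have "?D dvd fps_X"
    unfolding D by (metis dvd_refl mult_dvd_mono mult.right_neutral)
  then have "fps_X / ?D * ?D = fps_X"
    by (rule dvd_div_mult_self)
  then have "fps_X * (?E * (fps_X / ?D)) = fps_X * 1"
    unfolding D by (simp add: mult_ac)
  then have "?E * (fps_X / ?D) = 1"
    by (metis fps_X_neq_zero mult_cancel_left)
  then show ?thesis by (simp only: b)
qed

text \<open>The operator \<open>(exp (ad Z) - 1) / ad Z\<close> undoes \<open>ad Z / (exp (ad Z) - 1)\<close>.\<close>

lemma bernoulli_ad_inverse:
  fixes V Z Y :: "(real \<Rightarrow> 'b::real_algebra_1) fps"
  assumes Z: "vanishes_below 1 Z" and Y: "is_bernoulli_ad Z V Y"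
  shows "(\<lambda>m. scale_series (1 / fact (Suc m)) ((ad Z ^^ m) Y)) sums V"
proof -
  have "summable (\<lambda>m. scale_series (1 / fact (Suc m)) ((ad Z ^^ m) Y))"
    by (rule graded_summable) (rule graded_ad_series[OF Z])
  then obtain W where W: "(\<lambda>m. scale_series (1 / fact (Suc m)) ((ad Z ^^ m) Y)) sums W"
    by (auto simp: summable_def)
  have "(\<lambda>k. scale_series (fps_nth 1 k) ((ad Z ^^ k) V)) sums W"
    unfolding bernoulli_fps_mult[symmetric]
    by (rule ad_series_compose[OF Z]) (use Y W in \<open>simp_all add: is_bernoulli_ad_def\<close>)
  moreover have "(\<lambda>k. scale_series (fps_nth 1 k) ((ad Z ^^ k) V)) sums V"
  proof -
    have "(\<lambda>k. scale_series (fps_nth 1 k) ((ad Z ^^ k) V)) = (\<lambda>k. if k = 0 then V else 0)"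
      by (auto simp: fun_eq_iff scale_series_one scale_series_zero_left)
    then show ?thesis using sums_If_finite_set[of "{0}" "\<lambda>_. V"] by simp
  qed
  ultimately have "W = V" by (rule sums_unique2)
  then show ?thesis using W by simp
qed

section \<open>The time derivative of the exponential\<close>

text \<open>
  Induction step for the derivative of a power: if a derivation sends \<open>Z\<close> to \<open>Y\<close> and \<open>Z\<^sup>n\<close> to the
  sum on the left, then by the Leibniz rule it sends \<open>Z \<cdot> Z\<^sup>n\<close> to the whole left-hand side.  Moving
  \<open>Z\<close> past an iterated commutator \<open>v\<close> by \<open>Z v = ad Z v + v Z\<close> splits each term in two, and Pascal's
  rule collects them.
\<close>

lemma binomial_ad_step:
  fixes Z Y :: "'r::ring_1"
  shows "Y * Z ^ n + Z * (\<Sum>m<n. of_nat (n choose Suc m) * ((ad Z ^^ m) Y * Z ^ (n - Suc m)))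
    = (\<Sum>m<Suc n. of_nat (Suc n choose Suc m) * ((ad Z ^^ m) Y * Z ^ (n - m)))"
proof -
  let ?T = "\<lambda>m. (ad Z ^^ m) Y * Z ^ (n - m)"
  have split: "Z * (of_nat (n choose Suc m) * ((ad Z ^^ m) Y * Z ^ (n - Suc m)))
      = of_nat (n choose Suc m) * ?T (Suc m) + of_nat (n choose Suc m) * ?T m" if "m < n" for m
  proof -
    let ?c = "of_nat (n choose Suc m) :: 'r" and ?v = "(ad Z ^^ m) Y"
    have "Z * (?c * (?v * Z ^ (n - Suc m))) = ?c * ((Z * ?v) * Z ^ (n - Suc m))"
      by (metis (no_types) mult.assoc mult_of_nat_commute)
    also have "Z * ?v = (ad Z ^^ Suc m) Y + ?v * Z"
      by (simp add: ad_def)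
    also have "((ad Z ^^ Suc m) Y + ?v * Z) * Z ^ (n - Suc m) = ?T (Suc m) + ?v * Z ^ Suc (n - Suc m)"
      by (simp only: distrib_right mult.assoc power_Suc)
    also have "Suc (n - Suc m) = n - m" using that by simp
    finally show ?thesis by (simp only: distrib_left)
  qed
  have "Y * Z ^ n + Z * (\<Sum>m<n. of_nat (n choose Suc m) * ((ad Z ^^ m) Y * Z ^ (n - Suc m)))
      = (of_nat (n choose 0) * ?T 0 + (\<Sum>m<n. of_nat (n choose Suc m) * ?T (Suc m)))
        + (\<Sum>m<n. of_nat (n choose Suc m) * ?T m)"
    by (simp add: sum_distrib_left split sum.distrib add.assoc)
  also have "of_nat (n choose 0) * ?T 0 + (\<Sum>m<n. of_nat (n choose Suc m) * ?T (Suc m))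
      = (\<Sum>m<Suc n. of_nat (n choose m) * ?T m)"
    by (rule sum.lessThan_Suc_shift[symmetric])
  also have "(\<Sum>m<n. of_nat (n choose Suc m) * ?T m) = (\<Sum>m<Suc n. of_nat (n choose Suc m) * ?T m)"
    by (simp add: binomial_eq_0)
  also have "(\<Sum>m<Suc n. of_nat (n choose m) * ?T m) + (\<Sum>m<Suc n. of_nat (n choose Suc m) * ?T m)
      = (\<Sum>m<Suc n. of_nat (Suc n choose Suc m) * ?T m)"
    by (simp only: sum.distrib[symmetric] distrib_right[symmetric] of_nat_add[symmetric]
        binomial_Suc_Suc)
  finally show ?thesis .
qed

lemma has_time_derivative_one:
  "has_time_derivative (1 :: (real \<Rightarrow> 'b::{real_normed_algebra, real_algebra_1}) fps) 0"
  by (simp add: has_time_derivative_def one_fun_def zero_fun_def)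

lemma has_time_derivative_mult:
  fixes X Y X' Y' :: "(real \<Rightarrow> 'b::{real_normed_algebra, real_algebra_1}) fps"
  assumes "has_time_derivative X X'" and "has_time_derivative Y Y'"
  shows "has_time_derivative (X * Y) (X' * Y + X * Y')"
  unfolding has_time_derivative_def
proof (intro allI)
  fix n t
  have "((\<lambda>s. \<Sum>i=0..n. fps_nth X i s * fps_nth Y (n - i) s) has_vector_derivative
      (\<Sum>i=0..n. fps_nth X i t * fps_nth Y' (n - i) t + fps_nth X' i t * fps_nth Y (n - i) t)) (at t)"
    by (intro has_vector_derivative_sum has_vector_derivative_mult)
      (use assms in \<open>simp_all add: has_time_derivative_def\<close>)
  moreover have "(\<lambda>s. \<Sum>i=0..n. fps_nth X i s * fps_nth Y (n - i) s) = fps_nth (X * Y) n"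
    by (simp add: fun_eq_iff fps_mult_nth sum_fun_apply)
  ultimately show "(fps_nth (X * Y) n has_vector_derivative fps_nth (X' * Y + X * Y') n t) (at t)"
    by (simp add: fps_mult_nth sum_fun_apply sum.distrib add.commute)
qed

lemma has_time_derivative_scale:
  assumes "has_time_derivative X X'"
  shows "has_time_derivative (scale_series c X) (scale_series c X')"
  using assms by (auto simp: has_time_derivative_def intro!: derivative_eq_intros)

lemma has_time_derivative_sums:
  fixes f f' :: "nat \<Rightarrow> (real \<Rightarrow> 'b::real_normed_vector) fps"
  assumes "\<And>k. has_time_derivative (f k) (f' k)"
    and f: "\<And>k. vanishes_below k (f k)" "f sums F"
    and f': "\<And>k. vanishes_below k (f' k)" "f' sums F'"
  shows "has_time_derivative F F'"
  unfolding has_time_derivative_def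
proof (intro allI)
  fix n t
  have "((\<lambda>s. \<Sum>k\<le>n. fps_nth (f k) n s) has_vector_derivative (\<Sum>k\<le>n. fps_nth (f' k) n t)) (at t)"
    by (intro has_vector_derivative_sum) (use assms(1) in \<open>simp add: has_time_derivative_def\<close>)
  moreover have "fps_nth F n = (\<lambda>s. \<Sum>k\<le>n. fps_nth (f k) n s)"
    using f graded_sums_iff[OF f(1)] by (auto simp: fun_eq_iff sum_fun_apply)
  moreover have "fps_nth F' n t = (\<Sum>k\<le>n. fps_nth (f' k) n t)"
    using f' graded_sums_iff[OF f'(1)] by (auto simp: sum_fun_apply)
  ultimately show "(fps_nth F n has_vector_derivative fps_nth F' n t) (at t)" by simp
qed

lemma has_time_derivative_power:
  fixes Z Y :: "(real \<Rightarrow> 'b::{real_normed_algebra, real_algebra_1}) fps"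
  assumes "has_time_derivative Z Y"
  shows "has_time_derivative (Z ^ n)
    (\<Sum>m<n. of_nat (n choose Suc m) * ((ad Z ^^ m) Y * Z ^ (n - Suc m)))"
proof (induction n)
  case 0
  show ?case by (simp add: has_time_derivative_one)
next
  case (Suc n)
  show ?case
    using has_time_derivative_mult[OF assms Suc] unfolding binomial_ad_step by simp
qed

text \<open>Dividing the binomial formula for \<open>(Z\<^sup>n\<^sup>+\<^sup>1)'\<close> by \<open>(n + 1)!\<close> turns it into the \<open>n\<close>-th term of a
  Cauchy product of \<open>((exp (ad Z) - 1) / ad Z) Y\<close> and \<open>exp Z\<close>.\<close>

lemma has_time_derivative_exp_series:
  fixes Z Y V F :: "(real \<Rightarrow> 'b::{real_normed_algebra, real_algebra_1}) fps"
  assumes Z: "vanishes_below 1 Z" and Y: "vanishes_below 1 Y"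
    and deriv: "has_time_derivative Z Y"
    and V: "(\<lambda>m. scale_series (1 / fact (Suc m)) ((ad Z ^^ m) Y)) sums V"
    and F: "is_exp_series Z F"
  shows "has_time_derivative F (V * F)"
proof -
  define p where "p = (\<lambda>m. scale_series (1 / fact (Suc m)) ((ad Z ^^ m) Y))"
  define q where "q = (\<lambda>j. scale_series (1 / fact j) (Z ^ j))"
  \<comment> \<open>The shift by one reflects that \<open>Z\<^sup>0\<close> has derivative \<open>0\<close>.\<close>
  define f' where "f' = (\<lambda>k. case k of 0 \<Rightarrow> 0 | Suc k \<Rightarrow> \<Sum>m\<le>k. p m * q (k - m))"
  have p: "vanishes_below (Suc m) (p m)" for m
    unfolding p_def using vanishes_below_ad_pow[OF Z Y] by (simp add: vanishes_below_scale)
  have q: "vanishes_below j (q j)" for j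
    unfolding q_def using vanishes_below_power[OF Z] by (simp add: vanishes_below_scale)
  have "q sums F" using F by (simp add: q_def is_exp_series_def)
  have "has_time_derivative (q k) (f' k)" for k
  proof (cases k)
    case 0
    then show ?thesis
      by (simp add: q_def f'_def scale_series_one has_time_derivative_one)
  next
    case (Suc n)
    have "scale_series (1 / fact (Suc n))
        (of_nat (Suc n choose Suc m) * ((ad Z ^^ m) Y * Z ^ (n - m))) = p m * q (n - m)"
      if "m \<le> n" for m
    proof -
      have "1 / fact (Suc n) * real (Suc n choose Suc m) = 1 / fact (n - m) * (1 / fact (Suc m))"
        using that by (subst binomial_fact) (simp_all del: fact_Suc binomial_Suc_Suc)
      then show ?thesis
        by (simp only: p_def q_def scale_series_of_nat scale_series_scale
            scale_series_mult_left scale_series_mult_right)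
    qed
    then have "scale_series (1 / fact (Suc n))
        (\<Sum>m<Suc n. of_nat (Suc n choose Suc m) * ((ad Z ^^ m) Y * Z ^ (Suc n - Suc m))) = f' k"
      by (simp add: f'_def Suc scale_series_sum lessThan_Suc_atMost
          del: fact_Suc binomial_Suc_Suc sum.lessThan_Suc)
    then show ?thesis
      using has_time_derivative_scale[OF has_time_derivative_power[OF deriv, of "Suc n"],
          of "1 / fact (Suc n)"]
      by (simp only: q_def Suc)
  qed
  moreover have "vanishes_below k (f' k)" for k
  proof (cases k)
    case (Suc n)
    have "vanishes_below (Suc n) (p m * q (n - m))" if "m \<le> n" for m
      using vanishes_below_mult[OF p[of m] q[of "n - m"]] that by simp
    then show ?thesis by (auto simp: f'_def Suc intro!: vanishes_below_sum)
  qed simp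
  moreover have "f' sums (V * F)"
  proof -
    have "(\<lambda>k. \<Sum>m\<le>k. p m * q (k - m)) sums (V * F)"
      by (rule graded_sums_Cauchy_product)
        (use vanishes_below_mono[OF p] q \<open>q sums F\<close> V in \<open>simp_all add: p_def\<close>)
    then have "(\<lambda>N. \<Sum>k<Suc N. f' k) \<longlonglongrightarrow> V * F"
      by (simp add: sums_def f'_def sum.lessThan_Suc_shift del: sum.lessThan_Suc)
    then show ?thesis unfolding sums_def by (rule LIMSEQ_imp_Suc)
  qed
  ultimately show ?thesis
    using has_time_derivative_sums[OF _ q \<open>q sums F\<close>] by blast
qed

lemma exp_series_initial_value:
  fixes Z F :: "(real \<Rightarrow> 'b::real_algebra_1) fps"
  assumes Z: "vanishes_below 1 Z" and init: "\<And>n. fps_nth Z n t0 = 0" and F: "is_exp_series Z F"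
  shows "fps_nth F n t0 = (if n = 0 then 1 else 0)"
proof -
  have q: "vanishes_below k (scale_series (1 / fact k) (Z ^ k))" for k
    using vanishes_below_power[OF Z] by (simp add: vanishes_below_scale)
  have pow: "fps_nth (Z ^ k) n t0 = (if k = 0 \<and> n = 0 then 1 else 0)" for k
    by (cases k) (simp_all add: fps_mult_nth sum_fun_apply init)
  have "fps_nth F n = (\<Sum>k\<le>n. fps_nth (scale_series (1 / fact k) (Z ^ k)) n)"
    using F graded_sums_iff[OF q] unfolding is_exp_series_def by blast
  then have "fps_nth F n t0 = (\<Sum>k\<le>n. (1 / fact k) *\<^sub>R fps_nth (Z ^ k) n t0)"
    by (simp add: sum_fun_apply)
  also have "\<dots> = (\<Sum>k\<le>n. if k = 0 then (if n = 0 then 1 else 0) else 0)"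
    by (rule sum.cong) (simp_all add: pow)
  finally show ?thesis by simp
qed

section \<open>Existence and uniqueness for the CBHD recursion\<close>

text \<open>The fixed point is read off the iterates of \<open>\<Phi>\<close> at \<open>0\<close>, whose coefficient in degree \<open>n\<close> no longer
  changes from the step \<open>n + 1\<close> on.  Each of its coefficients is a coefficient of some iterate,
  and so belongs to \<open>A\<close>.\<close>

lemma fps_contraction_fixpoint:
  fixes \<Phi> :: "'r::ab_group_add fps \<Rightarrow> 'r fps"
  assumes contr: "\<And>n X Y. vanishes_below n (X - Y) \<Longrightarrow> vanishes_below (Suc n) (\<Phi> X - \<Phi> Y)"
    and closed: "\<And>X. X \<in> series_over A \<Longrightarrow> \<Phi> X \<in> series_over A" and "0 \<in> A"
  shows "\<exists>!X. X \<in> series_over A \<and> \<Phi> X = X"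
proof -
  define x where "x = (\<lambda>n. (\<Phi> ^^ n) 0)"
  define X where "X = Abs_fps (\<lambda>n. fps_nth (x (Suc n)) n)"
  have x_Suc: "x (Suc n) = \<Phi> (x n)" for n by (simp add: x_def)
  have x_closed: "x n \<in> series_over A" for n
    by (induction n) (use closed \<open>0 \<in> A\<close> in \<open>simp_all add: x_def series_over_def\<close>)
  have step: "vanishes_below n (x (Suc n) - x n)" for n
  proof (induction n)
    case (Suc n)
    then show ?case using contr[OF Suc] by (simp add: x_Suc)
  qed simp
  have stable: "fps_nth (x (Suc i + d)) i = fps_nth (x (Suc i)) i" for i d
  proof (induction d)
    case (Suc d)
    have "fps_nth (x (Suc (Suc i + d)) - x (Suc i + d)) i = 0"
      by (rule vanishes_below_nth[OF step]) simp
    then show ?case using Suc by simp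
  qed simp
  have X: "vanishes_below n (X - x n)" for n
    unfolding vanishes_below_def
  proof (intro allI impI)
    fix i assume "i < n"
    then obtain d where "n = Suc i + d" using less_iff_Suc_add by auto
    then show "fps_nth (X - x n) i = 0" using stable[of i d] by (simp add: X_def)
  qed
  have "\<Phi> X = X"
  proof (rule fps_ext)
    fix n
    have "fps_nth (\<Phi> X - x (Suc n)) n = 0" "fps_nth (X - x (Suc n)) n = 0"
      using vanishes_below_nth[OF contr[OF X[of n]]] vanishes_below_nth[OF X[of "Suc n"]]
      by (simp_all add: x_Suc)
    then show "fps_nth (\<Phi> X) n = fps_nth X n" by simp
  qed
  moreover have "X \<in> series_over A"
    using x_closed by (simp add: X_def series_over_def)
  moreover have "Y = X" if "\<Phi> Y = Y" for Y
  proof -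
    have "vanishes_below n (Y - X)" for n
    proof (induction n)
      case (Suc n)
      then show ?case using contr[OF Suc] \<open>\<Phi> X = X\<close> that by simp
    qed simp
    then show "Y = X" using vanishes_below_nth by (metis eq_iff_diff_eq_0 fps_ext fps_sub_nth lessI)
  qed
  ultimately show ?thesis by blast
qed

lemma vanishes_below_marked: "vanishes_below 1 (marked a)"
  by (simp add: vanishes_below_def marked_def)

lemma coeffwise_nth [simp]: "fps_nth (coeffwise T X) n = T (fps_nth X n)"
  by (simp add: coeffwise_def)

lemma bernoulli_ad_vanishes_below:
  fixes Z V U :: "(real \<Rightarrow> 'b::real_algebra_1) fps"
  assumes "is_bernoulli_ad Z V U" and "vanishes_below 1 V"
  shows "vanishes_below 1 U"
  using assms unfolding is_bernoulli_ad_def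
  by (elim sums_vanishes_below) (intro vanishes_below_scale vanishes_below_ad_pow_same)

context function_algebra
begin

lemma zero_closed: "0 \<in> A"
  using scale_closed[OF one_closed, of 0] by (simp add: zero_fun_def)

lemma diff_closed: "f \<in> A \<Longrightarrow> g \<in> A \<Longrightarrow> f - g \<in> A"
  using add_closed[OF _ scale_closed[of g "-1"], of f] by (simp add: plus_fun_def fun_diff_def)

lemma sum_closed: "(\<And>i. i \<in> S \<Longrightarrow> f i \<in> A) \<Longrightarrow> sum f S \<in> A"
  by (induction S rule: infinite_finite_induct) (auto simp: zero_closed add_closed)

lemma series_scale_closed: "X \<in> series_over A \<Longrightarrow> scale_series c X \<in> series_over A"
  by (simp add: series_over_def scale_closed)

lemma series_ad_pow_closed:
  assumes "Z \<in> series_over A" "X \<in> series_over A"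
  shows "(ad Z ^^ k) X \<in> series_over A"
  by (induction k)
    (use assms in \<open>auto simp: series_over_def ad_def fps_mult_nth
      intro!: diff_closed sum_closed mult_closed\<close>)

lemma series_marked_closed: "a \<in> A \<Longrightarrow> marked a \<in> series_over A"
  by (auto simp: series_over_def marked_def zero_closed)

lemma bernoulli_ad_closed:
  assumes "is_bernoulli_ad Z V U" and Z: "vanishes_below 1 Z"
    and "Z \<in> series_over A" "V \<in> series_over A"
  shows "U \<in> series_over A"
proof -
  have "fps_nth U n = (\<Sum>k\<le>n. fps_nth (scale_series (bernoulli_number k / fact k) ((ad Z ^^ k) V)) n)"
    for n
    using assms(1) unfolding is_bernoulli_ad_def ad_series_sums_iff[OF Z] by blast
  moreover have "fps_nth (scale_series c ((ad Z ^^ k) V)) n \<in> A" for c k n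
    using series_scale_closed[OF series_ad_pow_closed] assms(3,4)
    by (simp add: series_over_def del: scale_series_nth)
  ultimately show ?thesis by (simp add: series_over_def sum_closed del: scale_series_nth)
qed

text \<open>The right-hand side of the recursion, computed degree by degree with finite sums, is a total
  operator \<open>\<Phi>\<close>.  It has the same fixed points as the recursion: in both cases \<open>X\<close> starts in degree
  one, hence so does \<open>R X\<close>, and for such series the finite sums give the \<open>\<lambda>\<close>-adic limit.\<close>

lemma cbhd_recursion_ex1:
  assumes R0: "R 0 = 0" and R: "\<And>f. f \<in> A \<Longrightarrow> R f \<in> A" and "a \<in> A"
  shows "\<exists>!X. X \<in> series_over A \<and> is_bernoulli_ad (coeffwise R X) (marked a) X"
proof -
  define V where "V = marked a"
  define T where
    "T = (\<lambda>X k. scale_series (bernoulli_number k / fact k) ((ad (coeffwise R X) ^^ k) V))"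
  define \<Phi> where "\<Phi> = (\<lambda>X. Abs_fps (\<lambda>n. \<Sum>k\<le>n. fps_nth (T X k) n))"
  have V: "vanishes_below 1 V" unfolding V_def by (rule vanishes_below_marked)
  have "\<exists>!X. X \<in> series_over A \<and> \<Phi> X = X"
  proof (rule fps_contraction_fixpoint)
    fix n and X Y :: "(real \<Rightarrow> 'b) fps"
    assume "vanishes_below n (X - Y)"
    then have "vanishes_below n (coeffwise R X - coeffwise R Y)"
      by (simp add: vanishes_below_def)
    then have "vanishes_below (Suc n) (T X k - T Y k)" for k
      unfolding T_def scale_series_diff[symmetric]
      by (intro vanishes_below_scale ad_pow_perturbation V)
    then show "vanishes_below (Suc n) (\<Phi> X - \<Phi> Y)"
      unfolding vanishes_below_def \<Phi>_def by (simp add: sum_subtractf[symmetric])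
  next
    fix X assume "X \<in> series_over A"
    then have "coeffwise R X \<in> series_over A" by (simp add: series_over_def R)
    then have "T X k \<in> series_over A" for k
      unfolding T_def V_def
      by (intro series_scale_closed series_ad_pow_closed series_marked_closed \<open>a \<in> A\<close>)
    then show "\<Phi> X \<in> series_over A" by (simp add: \<Phi>_def series_over_def sum_closed)
  qed (rule zero_closed)
  moreover have "is_bernoulli_ad (coeffwise R X) V X \<longleftrightarrow> \<Phi> X = X" for X
  proof -
    have start: "vanishes_below 1 X" if "is_bernoulli_ad (coeffwise R X) V X \<or> \<Phi> X = X"
      using that
    proof
      assume "\<Phi> X = X"
      moreover have "fps_nth (\<Phi> X) 0 = 0"
        using vanishes_below_nth[OF V, of 0] by (simp add: \<Phi>_def T_def fun_eq_iff)
      ultimately show ?thesis by (simp add: vanishes_below_def)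
    qed (rule bernoulli_ad_vanishes_below[OF _ V])
    have "is_bernoulli_ad (coeffwise R X) V X \<longleftrightarrow> \<Phi> X = X" if "vanishes_below 1 X"
    proof -
      have "vanishes_below 1 (coeffwise R X)"
        using that R0 by (simp add: vanishes_below_def)
      then have "vanishes_below k (T X k)" for k
        unfolding T_def by (rule graded_ad_series)
      then have "T X sums X \<longleftrightarrow> (\<forall>n. fps_nth X n = (\<Sum>k\<le>n. fps_nth (T X k) n))"
        by (rule graded_sums_iff)
      moreover have "is_bernoulli_ad (coeffwise R X) V X \<longleftrightarrow> T X sums X"
        by (simp add: is_bernoulli_ad_def T_def)
      ultimately show ?thesis by (auto simp: \<Phi>_def fps_eq_iff)
    qed
    with start show ?thesis by blast
  qed
  ultimately show ?thesis by (simp add: V_def)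
qed

end

section \<open>The indefinite integral\<close>

lemma riemann_int_zero: "riemann_int (0 :: real \<Rightarrow> 'b::banach) = 0"
  by (simp add: riemann_int_def fun_eq_iff zero_fun_def)

lemma riemann_int_at_0: "riemann_int f 0 = 0"
  by (simp add: riemann_int_def)

lemma riemann_int_has_derivative:
  fixes f :: "real \<Rightarrow> 'b::banach"
  assumes f: "continuous_on UNIV f"
  shows "(riemann_int f has_vector_derivative f t) (at t)"
proof -
  \<comment> \<open>Base point left of both \<open>0\<close> and \<open>t\<close>, so that one formula covers both orientations near \<open>t\<close>.\<close>
  define c where "c = - \<bar>t\<bar> - 1"
  define d where "d = \<bar>t\<bar> + 1"
  have t: "c < t" "t < d" and c: "c \<le> 0" by (auto simp: c_def d_def)
  have int: "f integrable_on {u..v}" for u v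
    by (rule integrable_continuous_real) (rule continuous_on_subset[OF f], simp)
  have eq: "riemann_int f u = integral {c..u} f - integral {c..0} f" if "u \<in> {c..d}" for u
  proof (cases "0 \<le> u")
    case True
    then show ?thesis
      using Henstock_Kurzweil_Integration.integral_combine[OF c True int]
      by (simp add: riemann_int_def algebra_simps)
  next
    case False
    then show ?thesis
      using Henstock_Kurzweil_Integration.integral_combine[of c u 0 f, OF _ _ int] that
      by (simp add: riemann_int_def algebra_simps)
  qed
  have "((\<lambda>u. integral {c..u} f) has_vector_derivative f t) (at t within {c..d})"
    by (rule integral_has_vector_derivative) (use t f in \<open>auto intro: continuous_on_subset\<close>)
  then have "((\<lambda>u. integral {c..u} f - integral {c..0} f) has_vector_derivative f t)
      (at t within {c..d})"
    by (auto intro!: derivative_eq_intros)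
  then have "(riemann_int f has_vector_derivative f t) (at t within {c..d})"
    by (rule has_vector_derivative_transform[rotated 2]) (use t eq in auto)
  then show ?thesis using t by (simp add: at_within_Icc_at)
qed

lemma riemann_int_unique:
  fixes g :: "real \<Rightarrow> 'b::banach"
  assumes G: "\<And>t. (G has_vector_derivative g t) (at t)" and "G 0 = 0"
  shows "G = riemann_int g"
proof
  fix t
  have "(g has_integral (G v - G u)) {u..v}" if "u \<le> v" for u v
    by (rule fundamental_theorem_of_calculus[OF that]) (rule has_vector_derivative_at_within[OF G])
  then have "integral {u..v} g = G v - G u" if "u \<le> v" for u v
    using that by (simp add: integral_unique)
  then show "G t = riemann_int g t" by (simp add: riemann_int_def \<open>G 0 = 0\<close>)
qed

section \<open>Magnus' expansion and the CBHD recursion\<close>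

theorem corollary10p1:
  fixes A :: "(real \<Rightarrow> 'b::{real_normed_algebra, real_algebra_1, banach}) set"
    and a :: "real \<Rightarrow> 'b" and \<Omega> :: "(real \<Rightarrow> 'b) fps"
  assumes "function_algebra A" and "a \<in> A"
  shows "is_magnus_expansion A a \<Omega> \<longleftrightarrow> \<Omega> = coeffwise riemann_int (cbhd0 A riemann_int a)"
proof -
  interpret function_algebra A by fact
  let ?solves = "\<lambda>X. X \<in> series_over A \<and> is_bernoulli_ad (coeffwise riemann_int X) (marked a) X"
  have ex1: "\<exists>!X. ?solves X"
    by (rule cbhd_recursion_ex1) (use riemann_int_zero int_closed \<open>a \<in> A\<close> in auto)
  define X where "X = cbhd0 A riemann_int a"
  have X: "X \<in> series_over A" "is_bernoulli_ad (coeffwise riemann_int X) (marked a) X"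
    using theI'[OF ex1] by (simp_all add: X_def cbhd0_def)
  show ?thesis
  proof
    assume "is_magnus_expansion A a \<Omega>"
    then obtain W where \<Omega>: "\<Omega> \<in> series_over A" "fps_nth \<Omega> 0 = 0" "\<And>n. fps_nth \<Omega> n 0 = 0"
      and W: "is_bernoulli_ad \<Omega> (marked a) W" "has_time_derivative \<Omega> W"
      unfolding is_magnus_expansion_def by blast
    have \<Omega>_eq: "\<Omega> = coeffwise riemann_int W"
    proof (rule fps_ext)
      fix n
      have "fps_nth \<Omega> n = riemann_int (fps_nth W n)"
        by (rule riemann_int_unique) (use W(2) \<Omega>(3) in \<open>simp_all add: has_time_derivative_def\<close>)
      then show "fps_nth \<Omega> n = fps_nth (coeffwise riemann_int W) n" by simp
    qed
    have "W \<in> series_over A"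
      by (rule bernoulli_ad_closed[OF W(1) _ \<Omega>(1) series_marked_closed[OF \<open>a \<in> A\<close>]])
        (simp add: vanishes_below_def \<Omega>(2))
    with W(1) have "?solves W" by (simp add: \<Omega>_eq)
    then have "W = X" using ex1 X by blast
    then show "\<Omega> = coeffwise riemann_int (cbhd0 A riemann_int a)"
      using \<Omega>_eq by (simp add: X_def)
  next
    assume "\<Omega> = coeffwise riemann_int (cbhd0 A riemann_int a)"
    then have \<Omega>: "\<Omega> = coeffwise riemann_int X" by (simp add: X_def)
    have X1: "vanishes_below 1 X"
      by (rule bernoulli_ad_vanishes_below[OF X(2) vanishes_below_marked])
    then have \<Omega>1: "vanishes_below 1 \<Omega>"
      by (simp add: \<Omega> vanishes_below_def riemann_int_zero)
    have bern: "is_bernoulli_ad \<Omega> (marked a) X" using X(2) by (simp add: \<Omega>)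
    have deriv: "has_time_derivative \<Omega> X"
      using X(1) continuous
      by (simp add: \<Omega> has_time_derivative_def series_over_def riemann_int_has_derivative)
    have init: "fps_nth \<Omega> n 0 = 0" for n by (simp add: \<Omega> riemann_int_at_0)
    have "summable (\<lambda>n. scale_series (1 / fact n) (\<Omega> ^ n))"
      by (rule graded_summable) (intro vanishes_below_scale vanishes_below_power \<Omega>1)
    then obtain F where F: "is_exp_series \<Omega> F"
      by (auto simp: is_exp_series_def summable_def)
    have "has_time_derivative F (marked a * F)"
      by (rule has_time_derivative_exp_series[OF \<Omega>1 X1 deriv bernoulli_ad_inverse[OF \<Omega>1 bern] F])
    moreover have "\<forall>n. fps_nth F n 0 = (if n = 0 then 1 else 0)"
      using exp_series_initial_value[OF \<Omega>1 init F] by blast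
    moreover have "\<Omega> \<in> series_over A" using X(1) by (simp add: \<Omega> series_over_def int_closed)
    moreover have "fps_nth \<Omega> 0 = 0" using vanishes_below_nth[OF \<Omega>1, of 0] by simp
    ultimately show "is_magnus_expansion A a \<Omega>"
      unfolding is_magnus_expansion_def using init F bern deriv by blast
  qed
qed

end
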